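(* Let $(G,\precsim)$ be a C-quasi-ordered group and let $H$ be a strictly convex normal subgroup of $G$. Then $\precsim$ induces a (well-defined) C-quasi-order on $G/H$ by the formula $$gH\precsim hH\Leftrightarrow (g\in H)\vee(h\notin H\wedge g\precsim h).$$
   Context: A quasi-order is a reflexive, transitive and total binary relation $\precsim$; $a\sim b$ means $a\precsim b\precsim a$, and $a\precnsim b$ means $a\precsim b$ and $a\nsim b$. A subset $S$ is strictly convex if $s,t\in S$ and $s\precnsim a\precnsim t$ imply $a\in S$. A C-relation on a set is a ternary relation $C$ such that for all $x,y,z,w$: $C(x,y,z)\Rightarrow C(x,z,y)$; $C(x,y,z)\Rightarrow\neg C(y,x,z)$; $C(x,y,z)\Rightarrow C(w,y,z)\vee C(x,w,z)$; $x\neq y\Rightarrow C(x,y,y)$. On a group it is compatible if $C(x,y,z)$ implies $C(vxu,vyu,vzu)$ for all $x,y,z,u,v$. A C-quasi-order on a group $G$ is a quasi-order of the form $x\precsim y\Leftrightarrow\neg C(x,y,1)$ with $C$ a compatible C-relation on $G$; a C-quasi-ordered group is a group with a C-quasi-order. *)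

theory Defs
  imports "HOL-Algebra.Coset"
begin

definition quasi_order_on :: "'a set \<Rightarrow> ('a \<Rightarrow> 'a \<Rightarrow> bool) \<Rightarrow> bool" where
  "quasi_order_on A R \<longleftrightarrow> reflp_on A R \<and> transp_on A R \<and> totalp_on A R"

definition qo_equiv :: "('a \<Rightarrow> 'a \<Rightarrow> bool) \<Rightarrow> 'a \<Rightarrow> 'a \<Rightarrow> bool" where
  "qo_equiv R a b \<longleftrightarrow> R a b \<and> R b a"

definition qo_strict :: "('a \<Rightarrow> 'a \<Rightarrow> bool) \<Rightarrow> 'a \<Rightarrow> 'a \<Rightarrow> bool" where
  "qo_strict R a b \<longleftrightarrow> R a b \<and> \<not> qo_equiv R a b"

definition strictly_convex_on :: "'a set \<Rightarrow> ('a \<Rightarrow> 'a \<Rightarrow> bool) \<Rightarrow> 'a set \<Rightarrow> bool" where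
  "strictly_convex_on A R S \<longleftrightarrow> S \<subseteq> A \<and>
     (\<forall>s\<in>S. \<forall>t\<in>S. \<forall>a\<in>A. qo_strict R s a \<and> qo_strict R a t \<longrightarrow> a \<in> S)"

definition C_relation_on :: "'a set \<Rightarrow> ('a \<Rightarrow> 'a \<Rightarrow> 'a \<Rightarrow> bool) \<Rightarrow> bool" where
  "C_relation_on A C \<longleftrightarrow>
     (\<forall>x\<in>A. \<forall>y\<in>A. \<forall>z\<in>A. C x y z \<longrightarrow> C x z y) \<and>
     (\<forall>x\<in>A. \<forall>y\<in>A. \<forall>z\<in>A. C x y z \<longrightarrow> \<not> C y x z) \<and>
     (\<forall>x\<in>A. \<forall>y\<in>A. \<forall>z\<in>A. \<forall>w\<in>A. C x y z \<longrightarrow> C w y z \<or> C x w z) \<and>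
     (\<forall>x\<in>A. \<forall>y\<in>A. x \<noteq> y \<longrightarrow> C x y y)"

definition compatible_C_relation ::
  "('a, 'b) monoid_scheme \<Rightarrow> ('a \<Rightarrow> 'a \<Rightarrow> 'a \<Rightarrow> bool) \<Rightarrow> bool" where
  "compatible_C_relation G C \<longleftrightarrow> C_relation_on (carrier G) C \<and>
     (\<forall>x\<in>carrier G. \<forall>y\<in>carrier G. \<forall>z\<in>carrier G. \<forall>u\<in>carrier G. \<forall>v\<in>carrier G.
        C x y z \<longrightarrow>
        C (v \<otimes>\<^bsub>G\<^esub> x \<otimes>\<^bsub>G\<^esub> u) (v \<otimes>\<^bsub>G\<^esub> y \<otimes>\<^bsub>G\<^esub> u) (v \<otimes>\<^bsub>G\<^esub> z \<otimes>\<^bsub>G\<^esub> u))"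

definition C_quasi_order ::
  "('a, 'b) monoid_scheme \<Rightarrow> ('a \<Rightarrow> 'a \<Rightarrow> bool) \<Rightarrow> bool" where
  "C_quasi_order G R \<longleftrightarrow> quasi_order_on (carrier G) R \<and>
     (\<exists>C. compatible_C_relation G C \<and>
        (\<forall>x\<in>carrier G. \<forall>y\<in>carrier G. R x y \<longleftrightarrow> \<not> C x y \<one>\<^bsub>G\<^esub>))"

definition C_quasi_ordered_group ::
  "('a, 'b) monoid_scheme \<Rightarrow> ('a \<Rightarrow> 'a \<Rightarrow> bool) \<Rightarrow> bool" where
  "C_quasi_ordered_group G R \<longleftrightarrow> group G \<and> C_quasi_order G R"

text \<open>Two cosets are related as soon as \<^emph>\<open>some\<close> choice of representatives satisfies the
  defining formula, so well-definedness is the separate claim that the formula then holds for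
  \<^emph>\<open>every\<close> choice. For normal \<open>H\<close> the left cosets used here are the elements of
  \<open>carrier (G Mod H)\<close>, which the library defines as right cosets.\<close>
definition quotient_qo ::
  "('a, 'b) monoid_scheme \<Rightarrow> ('a \<Rightarrow> 'a \<Rightarrow> bool) \<Rightarrow> 'a set \<Rightarrow> 'a set \<Rightarrow> 'a set \<Rightarrow> bool" where
  "quotient_qo G R H A B \<longleftrightarrow>
     (\<exists>g\<in>carrier G. \<exists>h\<in>carrier G. A = g <#\<^bsub>G\<^esub> H \<and> B = h <#\<^bsub>G\<^esub> H \<and>
        (g \<in> H \<or> h \<notin> H \<and> R g h))"

end

theory Submission
  imports Defs
begin

text \<open>Write \<open>x \<equiv> y\<close> for equality of cosets modulo \<open>H\<close>. Since \<open>\<one>\<close> is the strict minimum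
  of the quasi-order, strict convexity says that \<open>H\<close> contains everything strictly below one of
  its elements; translating, \<open>C x y z\<close> and \<open>x \<equiv> y\<close> force \<open>z \<equiv> y\<close>. Consequently
  \<open>x \<not>\<equiv> z \<and> (y \<equiv> z \<or> C x y z)\<close> depends only on the cosets of \<open>x\<close>, \<open>y\<close>, \<open>z\<close>, and it is a
  compatible C-relation on the quotient which induces the quasi-order in question.\<close>

section \<open>C-relations, their quasi-orders and convexity\<close>

lemma C_relation_on_irrefl:
  assumes "C_relation_on A C" "x \<in> A" "z \<in> A"
  shows "\<not> C x x z"
  using assms unfolding C_relation_on_def by blast

text \<open>Transitivity is the contrapositive of the third axiom with the middle element as
  \<open>w\<close>, and totality is asymmetry.\<close>

lemma C_relation_on_quasi_order:
  assumes C: "C_relation_on A C" and e: "e \<in> A"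
    and R: "\<And>x y. \<lbrakk>x \<in> A; y \<in> A\<rbrakk> \<Longrightarrow> R x y \<longleftrightarrow> \<not> C x y e"
  shows "quasi_order_on A R"
  unfolding quasi_order_on_def
proof (intro conjI)
  show "reflp_on A R"
    using C_relation_on_irrefl[OF C] e R by (auto intro: reflp_onI)
  show "transp_on A R"
  proof (rule transp_onI)
    fix x y z
    assume xyz: "x \<in> A" "y \<in> A" "z \<in> A" and "R x y" "R y z"
    then have "\<not> C x y e" "\<not> C y z e"
      using R by blast+
    then have "\<not> C x z e"
      using C e xyz unfolding C_relation_on_def by blast
    then show "R x z"
      using R xyz by blast
  qed
  show "totalp_on A R"
  proof (rule totalp_onI)
    fix x y
    assume "x \<in> A" "y \<in> A"
    moreover from this have "\<not> C x y e \<or> \<not> C y x e"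
      using C e unfolding C_relation_on_def by blast
    ultimately show "R x y \<or> R y x"
      using R by blast
  qed
qed

lemma (in group) compatible_C_relation_translate_iff:
  assumes C: "compatible_C_relation G C"
    and x: "x \<in> carrier G" and y: "y \<in> carrier G" and z: "z \<in> carrier G" and u: "u \<in> carrier G"
  shows "C (x \<otimes> u) (y \<otimes> u) (z \<otimes> u) \<longleftrightarrow> C x y z"
proof -
  have translate: "C (x \<otimes> u) (y \<otimes> u) (z \<otimes> u)"
    if "C x y z" "x \<in> carrier G" "y \<in> carrier G" "z \<in> carrier G" "u \<in> carrier G" for x y z u
    using C that one_closed unfolding compatible_C_relation_def by (metis l_one)
  show ?thesis
    using translate[of x y z u] translate[of "x \<otimes> u" "y \<otimes> u" "z \<otimes> u" "inv u"] x y z u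
    by (auto simp: m_assoc)
qed

text \<open>\<open>C s a e\<close> puts \<open>a\<close> strictly below \<open>s\<close>, and
  \<open>C a e e\<close> puts \<open>e\<close> strictly below every other \<open>a\<close>. So any
  \<open>a\<close> other than \<open>e\<close> lies strictly between two elements of
  \<open>S\<close>.\<close>

lemma strictly_convex_C_below:
  assumes C: "C_relation_on A C" and e: "e \<in> A" "e \<in> S"
    and R: "\<And>x y. \<lbrakk>x \<in> A; y \<in> A\<rbrakk> \<Longrightarrow> R x y \<longleftrightarrow> \<not> C x y e"
    and S: "strictly_convex_on A R S"
    and s: "s \<in> S" and a: "a \<in> A" and below: "C s a e"
  shows "a \<in> S"
proof (cases "a = e")
  case False
  have sA: "s \<in> A"
    using S s unfolding strictly_convex_on_def by blast
  have "\<not> C a s e"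
    using C below sA a e unfolding C_relation_on_def by blast
  then have "qo_strict R a s"
    using R sA a below by (simp add: qo_strict_def qo_equiv_def)
  moreover have "C a e e" "\<not> C e a e"
    using C False a e unfolding C_relation_on_def by blast+
  then have "qo_strict R e a"
    using R e a by (simp add: qo_strict_def qo_equiv_def)
  ultimately show ?thesis
    using S e s a unfolding strictly_convex_on_def by blast
qed (use e in simp)

section \<open>The C-relation on cosets, expressed on representatives\<close>

locale convex_normal_subgroup = normal H G for H and G (structure) +
  fixes C :: "'a \<Rightarrow> 'a \<Rightarrow> 'a \<Rightarrow> bool"
  assumes compatible: "compatible_C_relation G C"
    and below: "\<And>s a. \<lbrakk>s \<in> H; a \<in> carrier G; C s a \<one>\<rbrakk> \<Longrightarrow> a \<in> H"
begin

lemma C_rel: "C_relation_on (carrier G) C"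
  using compatible by (simp add: compatible_C_relation_def)

lemma C_sym: "\<lbrakk>x \<in> carrier G; y \<in> carrier G; z \<in> carrier G; C x y z\<rbrakk> \<Longrightarrow> C x z y"
  and C_asym: "\<lbrakk>x \<in> carrier G; y \<in> carrier G; z \<in> carrier G; C x y z\<rbrakk> \<Longrightarrow> \<not> C y x z"
  and C_step: "\<lbrakk>x \<in> carrier G; y \<in> carrier G; z \<in> carrier G; w \<in> carrier G; C x y z\<rbrakk>
    \<Longrightarrow> C w y z \<or> C x w z"
  using C_rel unfolding C_relation_on_def by blast+

lemma rcos_eq_iff:
  assumes "x \<in> carrier G" "y \<in> carrier G"
  shows "H #> x = H #> y \<longleftrightarrow> x \<otimes> inv y \<in> H"
  using assms repr_independence[OF _ _ is_subgroup] rcos_self[OF _ is_subgroup]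
    rcos_module[OF is_group, of y x] is_subgroup
  by metis

text \<open>Right translation by \<open>inv y\<close> sends \<open>y\<close> to
  \<open>\<one>\<close> and \<open>x\<close> into \<open>H\<close>; symmetry of \<open>C\<close>
  then puts \<open>z \<otimes> inv y\<close> strictly below an element of \<open>H\<close>.\<close>

lemma rcos_eq_of_C:
  assumes x: "x \<in> carrier G" and y: "y \<in> carrier G" and z: "z \<in> carrier G"
    and C: "C x y z" and eq: "H #> x = H #> y"
  shows "H #> z = H #> y"
proof -
  have "C (x \<otimes> inv y) (y \<otimes> inv y) (z \<otimes> inv y)"
    using compatible_C_relation_translate_iff[OF compatible x y z inv_closed[OF y]] C by simp
  then have "C (x \<otimes> inv y) (z \<otimes> inv y) \<one>"
    using C_sym x y z by simp
  moreover have "x \<otimes> inv y \<in> H"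
    using eq rcos_eq_iff x y by simp
  ultimately show ?thesis
    using below[of "x \<otimes> inv y" "z \<otimes> inv y"] rcos_eq_iff y z by simp
qed

text \<open>The values on coinciding cosets are forced: a C-relation fails when its first and third
  arguments agree, and holds when the last two agree and differ from the first.\<close>

definition coset_C :: "'a \<Rightarrow> 'a \<Rightarrow> 'a \<Rightarrow> bool" where
  "coset_C x y z \<longleftrightarrow> H #> x \<noteq> H #> z \<and> (H #> y = H #> z \<or> C x y z)"

text \<open>The third argument stays fixed because the quotient order evaluates
  \<open>coset_C\<close> only at \<open>\<one>\<close> there.\<close>

lemma coset_C_cong_imp:
  assumes carr: "x \<in> carrier G" "y \<in> carrier G" "z \<in> carrier G" "x' \<in> carrier G" "y' \<in> carrier G"
    and eq: "H #> x = H #> x'" "H #> y = H #> y'"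
    and coset_C: "coset_C x y z"
  shows "coset_C x' y' z"
proof (cases "H #> y = H #> z")
  case True
  then show ?thesis using coset_C eq by (simp add: coset_C_def)
next
  case False
  then have C: "C x y z" and xz: "H #> x \<noteq> H #> z"
    using coset_C by (auto simp: coset_C_def)
  \<comment> \<open>Otherwise \<open>z\<close> would lie in the coset of \<open>x\<close>. This
    removes one alternative of \<open>C_step\<close>, so \<open>x\<close> can be exchanged for
    \<open>x'\<close>; \<open>y\<close> is exchanged in the same way below.\<close>
  have "\<not> C x x' z"
    using rcos_eq_of_C[of x x' z] carr eq xz by auto
  then have "C x' y z"
    using C_step[of x y z x'] C carr by blast
  moreover have "\<not> C y' y z"
    using rcos_eq_of_C[of y' y z] carr eq False by auto
  ultimately have "C x' y' z"
    using C_step[of x' y z y'] carr by blast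
  then show ?thesis
    using xz eq by (simp add: coset_C_def)
qed

text \<open>Right multiplication by \<open>u\<close> leaves \<open>a \<otimes> inv b\<close>
  unchanged, and this element decides equality of right cosets.\<close>

lemma coset_C_translate_iff:
  assumes "x \<in> carrier G" "y \<in> carrier G" "z \<in> carrier G" "u \<in> carrier G"
  shows "coset_C (x \<otimes> u) (y \<otimes> u) (z \<otimes> u) \<longleftrightarrow> coset_C x y z"
proof -
  have "u \<otimes> (inv u \<otimes> c) = c" if "c \<in> carrier G" for c
    using that assms(4) by (simp flip: m_assoc)
  then have "(a \<otimes> u) \<otimes> inv (b \<otimes> u) = a \<otimes> inv b" if "a \<in> carrier G" "b \<in> carrier G" for a b
    using that assms(4) by (simp add: inv_mult_group m_assoc)
  then have "H #> (a \<otimes> u) = H #> (b \<otimes> u) \<longleftrightarrow> H #> a = H #> b"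
    if "a \<in> carrier G" "b \<in> carrier G" for a b
    using that assms(4) by (simp add: rcos_eq_iff)
  then show ?thesis
    using assms compatible_C_relation_translate_iff[OF compatible] by (simp add: coset_C_def)
qed

text \<open>Left multiplication by \<open>v\<close> conjugates \<open>a \<otimes> inv b\<close>, so
  normality of \<open>H\<close> preserves equality of cosets.\<close>

lemma coset_C_left_translate:
  assumes "x \<in> carrier G" "y \<in> carrier G" "z \<in> carrier G" "v \<in> carrier G" and coset_C: "coset_C x y z"
  shows "coset_C (v \<otimes> x) (v \<otimes> y) (v \<otimes> z)"
proof -
  have conj: "v \<otimes> a \<otimes> inv (v \<otimes> b) = v \<otimes> (a \<otimes> inv b) \<otimes> inv v"
    if "a \<in> carrier G" "b \<in> carrier G" for a b
    using that assms(4) by (simp add: inv_mult_group m_assoc)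
  have "inv v \<otimes> (v \<otimes> w \<otimes> inv v) \<otimes> v = w" if "w \<in> carrier G" for w
    using that assms(4) by (simp add: m_assoc) (simp flip: m_assoc)
  then have "v \<otimes> w \<otimes> inv v \<in> H \<longleftrightarrow> w \<in> H" if "w \<in> carrier G" for w
    using that assms(4) inv_op_closed1 inv_op_closed2 by metis
  then have "H #> (v \<otimes> a) = H #> (v \<otimes> b) \<longleftrightarrow> H #> a = H #> b"
    if "a \<in> carrier G" "b \<in> carrier G" for a b
    using that assms(4) conj by (simp add: rcos_eq_iff)
  moreover have "C (v \<otimes> x) (v \<otimes> y) (v \<otimes> z)" if "C x y z"
    using that compatible assms(1-4) one_closed r_one m_closed
    unfolding compatible_C_relation_def by metis
  ultimately show ?thesis
    using assms by (auto simp: coset_C_def)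
qed

text \<open>The point is that \<open>x\<close> and \<open>y\<close> have distinct cosets: if they
  agreed, \<open>C x y z\<close> would put \<open>z\<close> in that coset too, against the first
  clause of \<open>coset_C\<close>.\<close>

lemma coset_C_sym:
  assumes "x \<in> carrier G" "y \<in> carrier G" "z \<in> carrier G" "coset_C x y z"
  shows "coset_C x z y"
  using assms rcos_eq_of_C[of x y z] C_sym[of x y z] unfolding coset_C_def by metis

lemma coset_C_asym:
  assumes "x \<in> carrier G" "y \<in> carrier G" "z \<in> carrier G" "coset_C x y z"
  shows "\<not> coset_C y x z"
  using assms C_asym[of x y z] unfolding coset_C_def by metis

lemma coset_C_step:
  assumes "x \<in> carrier G" "y \<in> carrier G" "z \<in> carrier G" "w \<in> carrier G" "coset_C x y z"
  shows "coset_C w y z \<or> coset_C x w z"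
  using assms C_step[of x y z w] unfolding coset_C_def by metis

section \<open>The induced quasi-order on the quotient group\<close>

lemma quotient_qo_iff:
  assumes R: "\<And>x y. \<lbrakk>x \<in> carrier G; y \<in> carrier G\<rbrakk> \<Longrightarrow> R x y \<longleftrightarrow> \<not> C x y \<one>"
    and g: "g \<in> carrier G" and h: "h \<in> carrier G"
  shows "quotient_qo G R H (H #> g) (H #> h) \<longleftrightarrow> \<not> coset_C g h \<one>"
    and "quotient_qo G R H (H #> g) (H #> h) \<longleftrightarrow> g \<in> H \<or> h \<notin> H \<and> R g h"
proof -
  \<comment> \<open>The coset of \<open>\<one>\<close> is \<open>H\<close>, so this is the negation
    of \<open>coset_C\<close> unfolded. Well-definedness thus reduces to
    \<open>coset_C_cong_imp\<close>.\<close>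
  have formula: "(x \<in> H \<or> y \<notin> H \<and> R x y) \<longleftrightarrow> \<not> coset_C x y \<one>"
    if "x \<in> carrier G" "y \<in> carrier G" for x y
    using that R by (auto simp: coset_C_def rcos_eq_iff)
  have lcos: "x <# H = H #> x" if "x \<in> carrier G" for x
    using that coset_eq by simp
  show *: "quotient_qo G R H (H #> g) (H #> h) \<longleftrightarrow> \<not> coset_C g h \<one>"
  proof
    assume "quotient_qo G R H (H #> g) (H #> h)"
    then obtain x y where xy: "x \<in> carrier G" "y \<in> carrier G" "\<not> coset_C x y \<one>"
      and "H #> g = H #> x" "H #> h = H #> y"
      unfolding quotient_qo_def using formula lcos by metis
    then show "\<not> coset_C g h \<one>"
      using coset_C_cong_imp[of g h \<one> x y] g h by auto
  next
    assume "\<not> coset_C g h \<one>"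
    then show "quotient_qo G R H (H #> g) (H #> h)"
      unfolding quotient_qo_def using formula lcos g h by metis
  qed
  show "quotient_qo G R H (H #> g) (H #> h) \<longleftrightarrow> g \<in> H \<or> h \<notin> H \<and> R g h"
    using * formula[OF g h] by simp
qed

lemma quotient_C_quasi_order:
  assumes R: "\<And>x y. \<lbrakk>x \<in> carrier G; y \<in> carrier G\<rbrakk> \<Longrightarrow> R x y \<longleftrightarrow> \<not> C x y \<one>"
  shows "C_quasi_order (G Mod H) (quotient_qo G R H)"
proof -
  interpret Q: group "G Mod H"
    by (rule factorgroup_is_group)
  let ?Q = "quotient_qo G R H"
  \<comment> \<open>Translating the third argument to the identity recovers a compatible C-relation
    from its quasi-order, without choosing representatives.\<close>
  define E where "E X Y Z \<longleftrightarrow>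
    \<not> ?Q (X \<otimes>\<^bsub>G Mod H\<^esub> inv\<^bsub>G Mod H\<^esub> Z) (Y \<otimes>\<^bsub>G Mod H\<^esub> inv\<^bsub>G Mod H\<^esub> Z)" for X Y Z
  have carrier: "carrier (G Mod H) = (\<lambda>x. H #> x) ` carrier G"
    by (auto simp: FactGroup_def RCOSETS_def)
  have mult: "(H #> x) \<otimes>\<^bsub>G Mod H\<^esub> (H #> y) = H #> (x \<otimes> y)"
    if "x \<in> carrier G" "y \<in> carrier G" for x y
    using that by (simp add: FactGroup_def rcos_sum)
  have E: "E (H #> x) (H #> y) (H #> z) \<longleftrightarrow> coset_C x y z"
    if xyz: "x \<in> carrier G" "y \<in> carrier G" "z \<in> carrier G" for x y z
  proof -
    have "inv\<^bsub>G Mod H\<^esub> (H #> z) = H #> inv z"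
      using xyz(3) carrier by (simp add: inv_FactGroup rcos_inv)
    then have "E (H #> x) (H #> y) (H #> z) \<longleftrightarrow> coset_C (x \<otimes> inv z) (y \<otimes> inv z) \<one>"
      using xyz by (simp add: E_def mult quotient_qo_iff(1)[OF R] del: mult_FactGroup)
    also have "\<dots> \<longleftrightarrow> coset_C x y z"
      using coset_C_translate_iff[of x y z "inv z"] xyz by simp
    finally show ?thesis .
  qed
  have C_rel_E: "C_relation_on (carrier (G Mod H)) E"
    unfolding C_relation_on_def carrier ball_simps
  proof (intro conjI ballI impI)
    show "E (H #> x) (H #> z) (H #> y)"
      if "x \<in> carrier G" "y \<in> carrier G" "z \<in> carrier G" "E (H #> x) (H #> y) (H #> z)" for x y z
      using that coset_C_sym by (simp add: E)
    show "\<not> E (H #> y) (H #> x) (H #> z)"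
      if "x \<in> carrier G" "y \<in> carrier G" "z \<in> carrier G" "E (H #> x) (H #> y) (H #> z)" for x y z
      using that coset_C_asym by (simp add: E)
    show "E (H #> w) (H #> y) (H #> z) \<or> E (H #> x) (H #> w) (H #> z)"
      if "x \<in> carrier G" "y \<in> carrier G" "z \<in> carrier G" "w \<in> carrier G"
        "E (H #> x) (H #> y) (H #> z)" for x y z w
      using that coset_C_step by (simp add: E)
    show "E (H #> x) (H #> y) (H #> y)"
      if "x \<in> carrier G" "y \<in> carrier G" "H #> x \<noteq> H #> y" for x y
      using that by (simp add: E coset_C_def)
  qed
  have compatible_E: "compatible_C_relation (G Mod H) E"
    unfolding compatible_C_relation_def
  proof (intro conjI ballI impI C_rel_E)
    fix X Y Z U V
    assume "X \<in> carrier (G Mod H)" "Y \<in> carrier (G Mod H)" "Z \<in> carrier (G Mod H)"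
      "U \<in> carrier (G Mod H)" "V \<in> carrier (G Mod H)" and EXYZ: "E X Y Z"
    then obtain x y z u v where
      carr: "x \<in> carrier G" "y \<in> carrier G" "z \<in> carrier G" "u \<in> carrier G" "v \<in> carrier G"
      and eqs: "X = H #> x" "Y = H #> y" "Z = H #> z" "U = H #> u" "V = H #> v"
      unfolding carrier by blast
    have "coset_C (v \<otimes> x \<otimes> u) (v \<otimes> y \<otimes> u) (v \<otimes> z \<otimes> u)"
      using EXYZ coset_C_left_translate coset_C_translate_iff carr by (simp add: eqs E)
    then show "E (V \<otimes>\<^bsub>G Mod H\<^esub> X \<otimes>\<^bsub>G Mod H\<^esub> U) (V \<otimes>\<^bsub>G Mod H\<^esub> Y \<otimes>\<^bsub>G Mod H\<^esub> U)
        (V \<otimes>\<^bsub>G Mod H\<^esub> Z \<otimes>\<^bsub>G Mod H\<^esub> U)"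
      using carr by (simp add: eqs mult E del: mult_FactGroup)
  qed
  have QE: "?Q X Y \<longleftrightarrow> \<not> E X Y \<one>\<^bsub>G Mod H\<^esub>"
    if "X \<in> carrier (G Mod H)" "Y \<in> carrier (G Mod H)" for X Y
    using that by (simp add: E_def del: one_FactGroup mult_FactGroup)
  show ?thesis
    \<comment> \<open>The quasi-order axioms on the quotient follow from \<open>E\<close> being a
      C-relation.\<close>
    unfolding C_quasi_order_def
    using C_relation_on_quasi_order[OF C_rel_E Q.one_closed QE] compatible_E QE by blast
qed

end

theorem proposition3p11:
  fixes G :: "('a, 'b) monoid_scheme"
    and R :: "'a \<Rightarrow> 'a \<Rightarrow> bool"
    and H :: "'a set"
  assumes "C_quasi_ordered_group G R"
    and "H \<lhd> G"
    and "strictly_convex_on (carrier G) R H"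
  shows "(\<forall>g\<in>carrier G. \<forall>h\<in>carrier G.
            quotient_qo G R H (g <#\<^bsub>G\<^esub> H) (h <#\<^bsub>G\<^esub> H) \<longleftrightarrow>
              (g \<in> H \<or> (h \<notin> H \<and> R g h)))
         \<and> C_quasi_order (G Mod H) (quotient_qo G R H)"
proof -
  obtain C where C: "compatible_C_relation G C"
    and R: "\<And>x y. \<lbrakk>x \<in> carrier G; y \<in> carrier G\<rbrakk> \<Longrightarrow> R x y \<longleftrightarrow> \<not> C x y \<one>\<^bsub>G\<^esub>"
    using assms(1) unfolding C_quasi_ordered_group_def C_quasi_order_def by blast
  interpret normal H G
    by (rule assms(2))
  interpret convex_normal_subgroup H G C
  proof
    \<comment> \<open>The identity lies in the subgroup \<open>H\<close> and serves as the lower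
      endpoint for convexity.\<close>
    show "a \<in> H" if "s \<in> H" "a \<in> carrier G" "C s a \<one>\<^bsub>G\<^esub>" for s a
      using strictly_convex_C_below[of "carrier G" C "\<one>\<^bsub>G\<^esub>" H R s a] C R assms(3) that
      by (simp add: compatible_C_relation_def)
  qed (rule C)
  \<comment> \<open>\<open>coset_eq\<close> identifies the left cosets of the claim with the right
    cosets used so far.\<close>
  show ?thesis
    using quotient_qo_iff(2)[OF R] quotient_C_quasi_order[OF R] coset_eq by simp
qed

end
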